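(* Let $T>0$ and let $H:[0,T]\to(0,1)$ be Hölder continuous with exponent $\gamma>\sup_{t\in[0,T]}H(t)$. Let $B$ be a standard Brownian motion. Fix $t\in[0,T)$ and, for sufficiently small $\epsilon>0$ (with $t+\epsilon\le T$), define the local dominant increment $$I_1^{\mathrm{loc}}:=\sqrt{2H(t+\epsilon)}\int_t^{t+\epsilon}(t+\epsilon-s)^{H(t+\epsilon)-1/2}\,dB(s).$$ Then $$\mathbb{E}\left[\left(I_1^{\mathrm{loc}}\right)^2\right]=\epsilon^{2H(t)}\left(1+O(\epsilon^\lambda)\right),\qquad \lambda=\min\left(\gamma-H(t),\frac{\gamma+H(t)}{2}\right),$$ where $O(\epsilon^\lambda)$ denotes a remainder term bounded in absolute value by $C\epsilon^\lambda$ for some constant $C>0$ and all sufficiently small $\epsilon>0$.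
   Context: A function $H:[0,T]\to(0,1)$ is Hölder continuous with exponent $\gamma>0$ if there is $C>0$ with $|H(t)-H(s)|\le C|t-s|^\gamma$ for all $t,s\in[0,T]$. The stochastic integral is the Itô integral of a deterministic integrand. *)

theory Defs
  imports "HOL-Probability.Probability" "HOL-Library.Landau_Symbols"
begin

definition Holder_continuous_on :: "real set \<Rightarrow> real \<Rightarrow> (real \<Rightarrow> real) \<Rightarrow> bool" where
  "Holder_continuous_on S \<gamma> f \<longleftrightarrow>
     \<gamma> > 0 \<and> (\<exists>C>0. \<forall>s\<in>S. \<forall>t\<in>S. \<bar>f t - f s\<bar> \<le> C * \<bar>t - s\<bar> powr \<gamma>)"

text \<open>Standard Brownian motion with time set \<open>I\<close>, typically \<open>{0..}\<close> or \<open>{0..T}\<close>.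
  The second argument of \<^const>\<open>normal_density\<close> is a standard deviation,
  so the increment over \<open>[s, t]\<close> has variance \<open>t - s\<close>.\<close>

locale standard_brownian_motion = prob_space M
  for M :: "'a measure" and I :: "real set" and B :: "real \<Rightarrow> 'a \<Rightarrow> real" +
  assumes random_variable: "t \<in> I \<Longrightarrow> B t \<in> borel_measurable M"
    and starts_at_0: "AE \<omega> in M. B 0 \<omega> = 0"
    and indep_increments:
      "(\<And>i. i \<le> n \<Longrightarrow> p i \<in> I) \<Longrightarrow> (\<And>i. i < n \<Longrightarrow> p i < p (Suc i)) \<Longrightarrow>
       indep_vars (\<lambda>_. borel) (\<lambda>i \<omega>. B (p (Suc i)) \<omega> - B (p i) \<omega>) {..<n}"
    and normal_increments:
      "s \<in> I \<Longrightarrow> t \<in> I \<Longrightarrow> s < t \<Longrightarrow>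
       distributed M lborel (\<lambda>\<omega>. B t \<omega> - B s \<omega>) (normal_density 0 (sqrt (t - s)))"
    and continuous_paths: "AE \<omega> in M. continuous_on I (\<lambda>t. B t \<omega>)"

definition is_partition :: "real \<Rightarrow> real \<Rightarrow> nat \<Rightarrow> (nat \<Rightarrow> real) \<Rightarrow> bool" where
  "is_partition a b n p \<longleftrightarrow> p 0 = a \<and> p n = b \<and> (\<forall>i<n. p i < p (Suc i))"

definition step_fun :: "nat \<Rightarrow> (nat \<Rightarrow> real) \<Rightarrow> (nat \<Rightarrow> real) \<Rightarrow> real \<Rightarrow> real" where
  "step_fun n p c s = (\<Sum>i<n. c i * indicator {p i<..p (Suc i)} s)"

definition step_integral ::
  "(real \<Rightarrow> 'a \<Rightarrow> real) \<Rightarrow> nat \<Rightarrow> (nat \<Rightarrow> real) \<Rightarrow> (nat \<Rightarrow> real) \<Rightarrow> 'a \<Rightarrow> real" where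
  "step_integral B n p c \<omega> = (\<Sum>i<n. c i * (B (p (Suc i)) \<omega> - B (p i) \<omega>))"

text \<open>The Ito integral of a deterministic integrand: \<open>X\<close> is (a version of) \<open>\<integral>\<^sub>a\<^sup>b f dB\<close> if it is the
  \<open>L\<^sup>2(M)\<close>-limit of the integrals of step functions that tend to \<open>f\<close> in \<open>L\<^sup>2([a, b])\<close>.
  The distances are measured by \<^const>\<open>nn_integral\<close>, which is \<open>\<infinity>\<close> rather than \<open>0\<close>
  on functions that are not square integrable.\<close>

definition has_ito_integral ::
  "'a measure \<Rightarrow> (real \<Rightarrow> 'a \<Rightarrow> real) \<Rightarrow> real \<Rightarrow> real \<Rightarrow> (real \<Rightarrow> real) \<Rightarrow> ('a \<Rightarrow> real) \<Rightarrow> bool" where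
  "has_ito_integral M B a b f X \<longleftrightarrow>
     X \<in> borel_measurable M \<and> set_borel_measurable lborel {a..b} f \<and>
     (\<exists>N P c. (\<forall>k. is_partition a b (N k) (P k)) \<and>
        (\<lambda>k. \<integral>\<^sup>+s\<in>{a..b}. ennreal ((f s - step_fun (N k) (P k) (c k) s)\<^sup>2) \<partial>lborel)
          \<longlonglongrightarrow> 0 \<and>
        (\<lambda>k. \<integral>\<^sup>+\<omega>. ennreal ((X \<omega> - step_integral B (N k) (P k) (c k) \<omega>)\<^sup>2) \<partial>M)
          \<longlonglongrightarrow> 0)"

text \<open>The integral is determined only up to null sets; the choice fixes one version.\<close>

definition ito_integral ::
  "'a measure \<Rightarrow> (real \<Rightarrow> 'a \<Rightarrow> real) \<Rightarrow> real \<Rightarrow> real \<Rightarrow> (real \<Rightarrow> real) \<Rightarrow> 'a \<Rightarrow> real" where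
  "ito_integral M B a b f = (SOME X. has_ito_integral M B a b f X)"

definition I1_loc ::
  "'a measure \<Rightarrow> (real \<Rightarrow> 'a \<Rightarrow> real) \<Rightarrow> (real \<Rightarrow> real) \<Rightarrow> real \<Rightarrow> real \<Rightarrow> 'a \<Rightarrow> real" where
  "I1_loc M B H t \<epsilon> \<omega> =
     sqrt (2 * H (t + \<epsilon>)) *
     ito_integral M B t (t + \<epsilon>) (\<lambda>s. (t + \<epsilon> - s) powr (H (t + \<epsilon>) - 1/2)) \<omega>"

end

theory Submission
  imports Defs "HOL-Real_Asymp.Real_Asymp"
begin

text \<open>By the Ito isometry, the second moment of the integral is the integral of the squared kernel
  \<open>(t + \<epsilon> - s) powr (2 * H (t + \<epsilon>) - 1)\<close> over \<open>[t, t + \<epsilon>]\<close>, which is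
  \<open>\<epsilon> powr (2 * H (t + \<epsilon>)) / (2 * H (t + \<epsilon>))\<close>,
  so with the normalizing factor it is exactly \<open>\<epsilon> powr (2 * H (t + \<epsilon>))\<close>
  (\<open>second_moment_I1_loc\<close>). The remainder is therefore
  \<open>\<epsilon> powr (2 * (H (t + \<epsilon>) - H t)) - 1\<close>. Hoelder continuity bounds the exponent by a multiple of
  \<open>\<epsilon> powr \<gamma>\<close>, so the remainder is of order \<open>\<epsilon> powr \<gamma> * \<bar>ln \<epsilon>\<bar>\<close>, and this is \<open>O(\<epsilon> powr \<beta>)\<close> for
  every \<open>\<beta> < \<gamma>\<close> (\<open>holder_exponent_perturbation_bigo\<close>). The exponent in the theorem is at most
  \<open>\<gamma> - H t\<close>, which is less than \<open>\<gamma>\<close> because \<open>H t > 0\<close>.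

  The integral is an arbitrary \<open>L\<^sup>2\<close> limit of integrals of step functions, so the
  isometry needs two things. Every such limit must have the right norm
  (\<open>ito_isometry\<close>): this follows from the isometry for step functions, because norms are
  preserved in the limit. And a limit must exist for the singular kernel
  (\<open>has_ito_integral_powr\<close>), since otherwise the choice that defines the integral would be
  arbitrary: the kernel is approximated by step functions, and the isometry for differences of
  step functions together with the completeness of \<open>L\<^sup>2\<close> yields the limit. For step functions the
  isometry rests on the fact that an increment of Brownian motion over an interval has the length of
  the interval as its second moment: by polarization this determines the covariances of all
  increments (\<open>increment_covariance\<close>), which are the lengths of the overlaps of the
  corresponding intervals.\<close>

section \<open>Square integrable limits\<close>

text \<open>Young's inequality for \<open>x = y + (x - y)\<close>. With the free parameter \<open>\<eta>\<close> it does the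
  work of the triangle inequality in \<open>L\<^sup>2\<close> while everything stays an integral of squares, so
  that no square roots of extended non-negative integrals occur.\<close>

lemma square_le_weighted:
  fixes x y :: real
  assumes "0 < \<eta>"
  shows "x\<^sup>2 \<le> (1 + \<eta>) * y\<^sup>2 + (1 + 1 / \<eta>) * (x - y)\<^sup>2"
proof -
  have "0 \<le> (\<eta> * y - (x - y))\<^sup>2 / \<eta>" using assms by simp
  also have "\<dots> = (1 + \<eta>) * y\<^sup>2 + (1 + 1 / \<eta>) * (x - y)\<^sup>2 - x\<^sup>2"
    using assms by (simp add: field_simps power2_eq_square)
  finally show ?thesis by simp
qed

lemma nn_integral_square_le_weighted:
  fixes f g :: "'a \<Rightarrow> real"
  assumes [measurable]: "f \<in> borel_measurable M" "g \<in> borel_measurable M"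
    and "0 < \<eta>"
  shows "(\<integral>\<^sup>+x. ennreal ((f x)\<^sup>2) \<partial>M) \<le> ennreal (1 + \<eta>) * (\<integral>\<^sup>+x. ennreal ((g x)\<^sup>2) \<partial>M) +
    ennreal (1 + 1 / \<eta>) * (\<integral>\<^sup>+x. ennreal ((f x - g x)\<^sup>2) \<partial>M)"
proof -
  have "(\<integral>\<^sup>+x. ennreal ((f x)\<^sup>2) \<partial>M) \<le>
      (\<integral>\<^sup>+x. ennreal (1 + \<eta>) * ennreal ((g x)\<^sup>2) + ennreal (1 + 1 / \<eta>) * ennreal ((f x - g x)\<^sup>2) \<partial>M)"
  proof (rule nn_integral_mono)
    fix x
    show "ennreal ((f x)\<^sup>2) \<le> ennreal (1 + \<eta>) * ennreal ((g x)\<^sup>2) + ennreal (1 + 1 / \<eta>) * ennreal ((f x - g x)\<^sup>2)"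
      using square_le_weighted[OF \<open>0 < \<eta>\<close>, of "f x" "g x"] \<open>0 < \<eta>\<close>
      by (simp add: ennreal_mult[symmetric] ennreal_plus[symmetric] del: ennreal_plus)
  qed
  also have "\<dots> = ennreal (1 + \<eta>) * (\<integral>\<^sup>+x. ennreal ((g x)\<^sup>2) \<partial>M) +
      ennreal (1 + 1 / \<eta>) * (\<integral>\<^sup>+x. ennreal ((f x - g x)\<^sup>2) \<partial>M)"
    by (subst nn_integral_add) (simp_all add: nn_integral_cmult)
  finally show ?thesis .
qed

text \<open>Norms pass to \<open>L\<^sup>2\<close> limits on two different measure spaces at once: \<open>f\<close> is close to
  \<open>g k\<close>, which has the norm of \<open>Y k\<close>, which is close to \<open>X\<close>, and the constants \<open>1 + \<eta>\<close> that
  are lost on the way tend to 1. The situation is symmetric in the two spaces, so this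
  inequality yields equality of the norms.\<close>

lemma nn_integral_square_le_of_isometric_approx:
  fixes f :: "'a \<Rightarrow> real" and X :: "'b \<Rightarrow> real" 
  assumes f: "f \<in> borel_measurable M" and g: "\<And>k. g k \<in> borel_measurable M"
    and X: "X \<in> borel_measurable N" and Y: "\<And>k. Y k \<in> borel_measurable N"
    and iso: "\<And>k. (\<integral>\<^sup>+x. ennreal ((g k x)\<^sup>2) \<partial>M) = (\<integral>\<^sup>+x. ennreal ((Y k x)\<^sup>2) \<partial>N)"
    and fg: "(\<lambda>k. \<integral>\<^sup>+x. ennreal ((f x - g k x)\<^sup>2) \<partial>M) \<longlonglongrightarrow> 0"
    and XY: "(\<lambda>k. \<integral>\<^sup>+x. ennreal ((X x - Y k x)\<^sup>2) \<partial>N) \<longlonglongrightarrow> 0"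
  shows "(\<integral>\<^sup>+x. ennreal ((f x)\<^sup>2) \<partial>M) \<le> (\<integral>\<^sup>+x. ennreal ((X x)\<^sup>2) \<partial>N)"
proof -
  define F where "F = (\<integral>\<^sup>+x. ennreal ((f x)\<^sup>2) \<partial>M)"
  define E where "E = (\<integral>\<^sup>+x. ennreal ((X x)\<^sup>2) \<partial>N)"
  define u where "u k = (\<integral>\<^sup>+x. ennreal ((f x - g k x)\<^sup>2) \<partial>M)" for k
  define v where "v k = (\<integral>\<^sup>+x. ennreal ((X x - Y k x)\<^sup>2) \<partial>N)" for k
  have step: "F \<le> ennreal ((1 + \<eta>)\<^sup>2) * E" if "0 < \<eta>" for \<eta>
  proof -
    define a where "a = ennreal (1 + \<eta>)"
    define b where "b = ennreal (1 + 1 / \<eta>)"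
    have "F \<le> a * (a * E + b * v k) + b * u k" for k
    proof -
      have "F \<le> a * (\<integral>\<^sup>+x. ennreal ((g k x)\<^sup>2) \<partial>M) + b * u k"
        unfolding F_def u_def a_def b_def
        by (rule nn_integral_square_le_weighted[OF f g that])
      also have "(\<integral>\<^sup>+x. ennreal ((g k x)\<^sup>2) \<partial>M) \<le> a * E + b * v k"
        unfolding iso E_def v_def a_def b_def
        using nn_integral_square_le_weighted[OF Y X that, of k]
        by (simp add: power2_commute)
      finally show ?thesis by (simp add: mult_left_mono add_right_mono)
    qed
    moreover have "(\<lambda>k. a * (a * E + b * v k) + b * u k) \<longlonglongrightarrow> a * (a * E + b * 0) + b * 0"
      by (intro tendsto_intros ennreal_tendsto_cmult fg[folded u_def] XY[folded v_def])
         (auto simp: a_def b_def)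
    ultimately have "F \<le> a * (a * E + b * 0) + b * 0"
      by (meson LIMSEQ_le_const)
    also have "\<dots> = ennreal ((1 + \<eta>)\<^sup>2) * E"
      using that by (simp add: a_def mult.assoc[symmetric] ennreal_mult power2_eq_square)
    finally show ?thesis .
  qed
  show ?thesis
  proof (cases "E = \<infinity>")
    case True
    then show ?thesis by (simp add: E_def)
  next
    case False
    have "(\<lambda>n. 1 / real (Suc n)) \<longlonglongrightarrow> 0"
      by (rule LIMSEQ_Suc[OF lim_1_over_n])
    then have "(\<lambda>n. ennreal ((1 + 1 / real (Suc n))\<^sup>2) * E) \<longlonglongrightarrow> ennreal ((1 + 0)\<^sup>2) * E"
      using False
      by (intro tendsto_mult_ennreal tendsto_ennrealI tendsto_intros) auto
    then have "F \<le> ennreal ((1 + 0)\<^sup>2) * E"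
      by (rule LIMSEQ_le_const) (use step in \<open>auto simp del: of_nat_Suc\<close>)
    then show ?thesis by (simp add: F_def E_def)
  qed
qed

text \<open>The completeness of \<open>L\<^sup>2\<close> for sequences that converge geometrically. Young's inequality
  \<open>\<bar>d\<bar> \<le> (1/2)^k + 2^k * d\<^sup>2\<close> turns the bounds on the squared increments into summable bounds on
  their means, so the sequence converges almost surely; Fatou's lemma then gives the rate of
  convergence to the pointwise limit.\<close>

lemma (in prob_space) L2_limit_exists:
  fixes S :: "nat \<Rightarrow> 'a \<Rightarrow> real" and K :: real
  assumes S[measurable]: "\<And>k. S k \<in> borel_measurable M"
    and cauchy: "\<And>j k. k \<le> j \<Longrightarrow> (\<integral>\<^sup>+\<omega>. ennreal ((S j \<omega> - S k \<omega>)\<^sup>2) \<partial>M) \<le> ennreal (K * (1/4) ^ k)"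
    and "0 \<le> K"
  obtains X where "X \<in> borel_measurable M"
    and "(\<lambda>k. \<integral>\<^sup>+\<omega>. ennreal ((X \<omega> - S k \<omega>)\<^sup>2) \<partial>M) \<longlonglongrightarrow> 0"
proof -
  define X where "X \<omega> = lim (\<lambda>k. S k \<omega>)" for \<omega>
  have X[measurable]: "X \<in> borel_measurable M"
    unfolding X_def by measurable
  have increment: "(\<integral>\<^sup>+\<omega>. ennreal \<bar>S (Suc k) \<omega> - S k \<omega>\<bar> \<partial>M) \<le> ennreal ((1 + K) * (1/2)^k)" for k
  proof -
    have "\<bar>d\<bar> \<le> (1/2)^k + 2^k * d\<^sup>2" for d :: real
    proof -
      have e: "(2::real)^k * (1/2)^k = 1" by (simp add: power_mult_distrib[symmetric])
      show ?thesis
      proof (cases "\<bar>d\<bar> \<le> (1/2)^k")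
        case True
        then show ?thesis by (rule order_trans) simp
      next
        case False
        then have "2^k * (1/2)^k * \<bar>d\<bar> \<le> 2^k * \<bar>d\<bar> * \<bar>d\<bar>"
          by (intro mult_right_mono mult_left_mono) auto
        then have "\<bar>d\<bar> \<le> 2^k * d\<^sup>2"
          unfolding e by (simp add: power2_eq_square mult.assoc)
        then show ?thesis by (rule order_trans) simp
      qed
    qed
    then have "(\<integral>\<^sup>+\<omega>. ennreal \<bar>S (Suc k) \<omega> - S k \<omega>\<bar> \<partial>M) \<le>
        (\<integral>\<^sup>+\<omega>. ennreal ((1/2)^k) + ennreal (2^k) * ennreal ((S (Suc k) \<omega> - S k \<omega>)\<^sup>2) \<partial>M)"
      by (intro nn_integral_mono) (simp add: ennreal_mult[symmetric] ennreal_plus[symmetric] del: ennreal_plus)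
    also have "\<dots> = ennreal ((1/2)^k) + ennreal (2^k) * (\<integral>\<^sup>+\<omega>. ennreal ((S (Suc k) \<omega> - S k \<omega>)\<^sup>2) \<partial>M)"
      by (subst nn_integral_add) (simp_all add: nn_integral_cmult emeasure_space_1)
    also have "\<dots> \<le> ennreal ((1/2)^k) + ennreal (2^k) * ennreal (K * (1/4)^k)"
      by (intro add_left_mono mult_left_mono cauchy) auto
    also have "\<dots> = ennreal ((1/2)^k + 2^k * (K * (1/4)^k))"
      using \<open>0 \<le> K\<close> by (simp add: ennreal_mult[symmetric] ennreal_plus[symmetric] del: ennreal_plus)
    also have "(1/2)^k + 2^k * (K * (1/4)^k) = (1 + K) * (1/2)^k"
      by (simp add: field_simps power_mult_distrib[symmetric])
    finally show ?thesis .
  qed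
  have "(\<integral>\<^sup>+\<omega>. (\<Sum>k. ennreal \<bar>S (Suc k) \<omega> - S k \<omega>\<bar>) \<partial>M) =
      (\<Sum>k. \<integral>\<^sup>+\<omega>. ennreal \<bar>S (Suc k) \<omega> - S k \<omega>\<bar> \<partial>M)"
    by (rule nn_integral_suminf) simp
  also have "\<dots> \<le> (\<Sum>k. ennreal ((1 + K) * (1/2)^k))"
    by (intro suminf_le increment) auto
  also have "\<dots> < \<infinity>"
    using \<open>0 \<le> K\<close> by (subst suminf_ennreal_eq[where x = "(1 + K) * 2"]) 
      (use geometric_sums[of "1/2::real", THEN sums_mult, of "1 + K"] in auto)
  finally have "AE \<omega> in M. (\<Sum>k. ennreal \<bar>S (Suc k) \<omega> - S k \<omega>\<bar>) \<noteq> \<infinity>"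
    by (intro nn_integral_PInf_AE) auto
  then have conv: "AE \<omega> in M. (\<lambda>k. S k \<omega>) \<longlonglongrightarrow> X \<omega>"
  proof eventually_elim
    case (elim \<omega>)
    then have "summable (\<lambda>k. \<bar>S (Suc k) \<omega> - S k \<omega>\<bar>)"
      by (intro summable_suminf_not_top) auto
    then have "convergent (\<lambda>n. \<Sum>k<n. S (Suc k) \<omega> - S k \<omega>)"
      using summable_rabs_cancel summable_iff_convergent by blast
    then have "convergent (\<lambda>n. S n \<omega> - S 0 \<omega>)"
      by (simp add: sum_lessThan_telescope[of "\<lambda>k. S k \<omega>"])
    then have "convergent (\<lambda>n. S n \<omega>)"
      by (simp add: convergent_diff_const_right_iff)
    then show ?case by (simp add: X_def convergent_LIMSEQ_iff)
  qed
  have bound: "(\<integral>\<^sup>+\<omega>. ennreal ((X \<omega> - S k \<omega>)\<^sup>2) \<partial>M) \<le> ennreal (K * (1/4)^k)" for k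
  proof -
    have "(\<integral>\<^sup>+\<omega>. ennreal ((X \<omega> - S k \<omega>)\<^sup>2) \<partial>M) =
        (\<integral>\<^sup>+\<omega>. liminf (\<lambda>j. ennreal ((S j \<omega> - S k \<omega>)\<^sup>2)) \<partial>M)"
    proof (rule nn_integral_cong_AE, use conv in eventually_elim)
      case (elim \<omega>)
      then have "(\<lambda>j. ennreal ((S j \<omega> - S k \<omega>)\<^sup>2)) \<longlonglongrightarrow> ennreal ((X \<omega> - S k \<omega>)\<^sup>2)"
        by (intro tendsto_intros tendsto_ennrealI)
      then show ?case by (rule lim_imp_Liminf[OF trivial_limit_sequentially, symmetric])
    qed
    also have "\<dots> \<le> liminf (\<lambda>j. \<integral>\<^sup>+\<omega>. ennreal ((S j \<omega> - S k \<omega>)\<^sup>2) \<partial>M)"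
      by (rule nn_integral_liminf) simp
    also have "\<dots> \<le> ennreal (K * (1/4)^k)"
      by (rule order_trans[OF Liminf_le_Limsup Limsup_bounded])
         (auto intro: eventually_sequentiallyI[of k] cauchy)
    finally show ?thesis .
  qed
  have "(\<lambda>k. K * (1/4::real)^k) \<longlonglongrightarrow> K * 0"
    by (intro tendsto_intros LIMSEQ_realpow_zero) auto
  then have "(\<lambda>k. ennreal (K * (1/4)^k)) \<longlonglongrightarrow> 0"
    using tendsto_ennrealI by fastforce
  then have "(\<lambda>k. \<integral>\<^sup>+\<omega>. ennreal ((X \<omega> - S k \<omega>)\<^sup>2) \<partial>M) \<longlonglongrightarrow> 0"
    by (rule tendsto_sandwich[OF _ _ tendsto_const, rotated 2]) (auto simp: bound)
  then show ?thesis using that X by blast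
qed

section \<open>The isometry for step functions\<close>

text \<open>The overlap length of two intervals is written in the form that polarization yields for the
  covariance of two Brownian increments.\<close>

lemma integral_overlap:
  fixes a b c d :: real
  assumes "a \<le> b" "c \<le> d"
  shows "integrable lborel (\<lambda>s. indicator {a<..b} s * indicator {c<..d} s :: real)"
    and "(\<integral>s. indicator {a<..b} s * indicator {c<..d} s \<partial>lborel) =
      (\<bar>b - c\<bar> + \<bar>a - d\<bar> - \<bar>b - d\<bar> - \<bar>a - c\<bar>) / 2"
proof -
  have eq: "(\<lambda>s. indicator {a<..b} s * indicator {c<..d} s :: real) = indicator {max a c<..min b d}"
    by (auto simp: indicator_def fun_eq_iff)
  show "integrable lborel (\<lambda>s. indicator {a<..b} s * indicator {c<..d} s :: real)"
    unfolding eq by (cases "max a c \<le> min b d") auto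
  show "(\<integral>s. indicator {a<..b} s * indicator {c<..d} s \<partial>lborel) =
      (\<bar>b - c\<bar> + \<bar>a - d\<bar> - \<bar>b - d\<bar> - \<bar>a - c\<bar>) / 2"
    unfolding eq using assms by (cases "max a c \<le> min b d") (auto simp: max_def min_def abs_if split: if_splits)
qed

context standard_brownian_motion
begin

lemma increment_second_moment:
  assumes "s \<in> I" "t \<in> I"
  shows "integrable M (\<lambda>\<omega>. (B t \<omega> - B s \<omega>)\<^sup>2)"
    and "expectation (\<lambda>\<omega>. (B t \<omega> - B s \<omega>)\<^sup>2) = \<bar>t - s\<bar>"
proof -
  have *: "integrable M (\<lambda>\<omega>. (B v \<omega> - B u \<omega>)\<^sup>2) \<and> expectation (\<lambda>\<omega>. (B v \<omega> - B u \<omega>)\<^sup>2) = v - u"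
    if "u \<in> I" "v \<in> I" "u < v" for u v
  proof -
    have D: "distributed M lborel (\<lambda>\<omega>. B v \<omega> - B u \<omega>) (normal_density 0 (sqrt (v - u)))"
      using that by (rule normal_increments)
    have "integrable lborel (\<lambda>x. normal_density 0 (sqrt (v - u)) x * x\<^sup>2)"
      using integrable_normal_moment[of "sqrt (v - u)" 0 2] that by simp
    then have 1: "integrable M (\<lambda>\<omega>. (B v \<omega> - B u \<omega>)\<^sup>2)"
      by (subst (asm) distributed_integrable[OF D]) simp_all
    have "(\<integral>x. normal_density 0 (sqrt (v - u)) x * x\<^sup>2 \<partial>lborel) = v - u"
      using integral_normal_moment_even[of "sqrt (v - u)" 0 1] that
      by (simp add: eval_nat_numeral(1) power2_eq_square)
    then have "expectation (\<lambda>\<omega>. (B v \<omega> - B u \<omega>)\<^sup>2) = v - u"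
      by (subst (asm) distributed_integral[OF D]) simp_all
    with 1 show ?thesis by simp
  qed
  consider "s < t" | "s = t" | "t < s" by linarith
  then have "integrable M (\<lambda>\<omega>. (B t \<omega> - B s \<omega>)\<^sup>2) \<and> expectation (\<lambda>\<omega>. (B t \<omega> - B s \<omega>)\<^sup>2) = \<bar>t - s\<bar>"
  proof cases
    case 1
    then show ?thesis using *[OF assms] by simp
  next
    case 2
    then show ?thesis by simp
  next
    case 3
    then show ?thesis using *[OF assms(2,1)] by (simp add: power2_commute)
  qed
  then show "integrable M (\<lambda>\<omega>. (B t \<omega> - B s \<omega>)\<^sup>2)"
    "expectation (\<lambda>\<omega>. (B t \<omega> - B s \<omega>)\<^sup>2) = \<bar>t - s\<bar>" by auto
qed

text \<open>Polarization expresses a product of two increments by squares of four other increments. Hence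
  the second moments of single increments determine all covariances, also for overlapping
  intervals.\<close>

lemma increment_covariance:
  assumes "a \<in> I" "b \<in> I" "c \<in> I" "d \<in> I" "a \<le> b" "c \<le> d"
  shows "integrable M (\<lambda>\<omega>. (B b \<omega> - B a \<omega>) * (B d \<omega> - B c \<omega>))"
    and "expectation (\<lambda>\<omega>. (B b \<omega> - B a \<omega>) * (B d \<omega> - B c \<omega>)) =
      (\<integral>s. indicator {a<..b} s * indicator {c<..d} s \<partial>lborel)"
proof -
  have eq: "(\<lambda>\<omega>. (B b \<omega> - B a \<omega>) * (B d \<omega> - B c \<omega>)) =
      (\<lambda>\<omega>. ((B b \<omega> - B c \<omega>)\<^sup>2 + (B a \<omega> - B d \<omega>)\<^sup>2 - (B b \<omega> - B d \<omega>)\<^sup>2 - (B a \<omega> - B c \<omega>)\<^sup>2) / 2)"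
    by (simp add: fun_eq_iff power2_eq_square algebra_simps)
  note [simp] = increment_second_moment assms(1-4)
  show "integrable M (\<lambda>\<omega>. (B b \<omega> - B a \<omega>) * (B d \<omega> - B c \<omega>))"
    unfolding eq by (intro integrable_divide Bochner_Integration.integrable_diff Bochner_Integration.integrable_add) simp_all
  show "expectation (\<lambda>\<omega>. (B b \<omega> - B a \<omega>) * (B d \<omega> - B c \<omega>)) =
      (\<integral>s. indicator {a<..b} s * indicator {c<..d} s \<partial>lborel)"
    unfolding eq integral_overlap(2)[OF assms(5,6)] by simp
qed

text \<open>Both sides are the quadratic form of the coefficients \<open>c\<close> with the same matrix, that of the
  overlaps of the intervals. Since these may overlap arbitrarily, the lemma also
  covers the difference of two step functions on unrelated partitions, and no common refinement
  has to be formed.\<close>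

lemma isometry_of_increment_combinations:
  fixes c l r :: "'i \<Rightarrow> real"
  assumes "finite A" and I: "\<And>i. i \<in> A \<Longrightarrow> l i \<in> I" "\<And>i. i \<in> A \<Longrightarrow> r i \<in> I"
    and le: "\<And>i. i \<in> A \<Longrightarrow> l i \<le> r i"
  shows "(\<integral>\<^sup>+s. ennreal ((\<Sum>i\<in>A. c i * indicator {l i<..r i} s)\<^sup>2) \<partial>lborel) =
    (\<integral>\<^sup>+\<omega>. ennreal ((\<Sum>i\<in>A. c i * (B (r i) \<omega> - B (l i) \<omega>))\<^sup>2) \<partial>M)"
proof -
  define D where "D i \<omega> = B (r i) \<omega> - B (l i) \<omega>" for i \<omega>
  define J :: "'i \<Rightarrow> real \<Rightarrow> real" where "J i = indicator {l i<..r i}" for i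
  define \<kappa> where "\<kappa> i j = (\<integral>s. J i s * J j s \<partial>lborel)" for i j
  define V where "V = (\<Sum>i\<in>A. \<Sum>j\<in>A. (c i * c j) * \<kappa> i j)"
  have D: "has_bochner_integral M (\<lambda>\<omega>. D i \<omega> * D j \<omega>) (\<kappa> i j)" if "i \<in> A" "j \<in> A" for i j
    using that unfolding has_bochner_integral_iff D_def J_def \<kappa>_def
    by (auto intro!: increment_covariance I le)
  have J: "has_bochner_integral lborel (\<lambda>s. J i s * J j s) (\<kappa> i j)" if "i \<in> A" "j \<in> A" for i j
    using that unfolding has_bochner_integral_iff J_def \<kappa>_def by (auto intro!: integral_overlap le)
  have sqD: "(\<lambda>\<omega>. (\<Sum>i\<in>A. c i * D i \<omega>)\<^sup>2) = (\<lambda>\<omega>. \<Sum>i\<in>A. \<Sum>j\<in>A. (c i * c j) * (D i \<omega> * D j \<omega>))"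
    by (simp add: fun_eq_iff power2_eq_square sum_product mult_ac)
  have sqJ: "(\<lambda>s. (\<Sum>i\<in>A. c i * J i s)\<^sup>2) = (\<lambda>s. \<Sum>i\<in>A. \<Sum>j\<in>A. (c i * c j) * (J i s * J j s))"
    by (simp add: fun_eq_iff power2_eq_square sum_product mult_ac)
  have "has_bochner_integral M (\<lambda>\<omega>. (\<Sum>i\<in>A. c i * D i \<omega>)\<^sup>2) V"
    unfolding sqD V_def by (intro has_bochner_integral_sum has_bochner_integral_mult_right D)
  moreover have "has_bochner_integral lborel (\<lambda>s. (\<Sum>i\<in>A. c i * J i s)\<^sup>2) V"
    unfolding sqJ V_def by (intro has_bochner_integral_sum has_bochner_integral_mult_right J)
  ultimately have "(\<integral>\<^sup>+s. ennreal ((\<Sum>i\<in>A. c i * J i s)\<^sup>2) \<partial>lborel) =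
    (\<integral>\<^sup>+\<omega>. ennreal ((\<Sum>i\<in>A. c i * D i \<omega>)\<^sup>2) \<partial>M)"
    by (simp add: has_bochner_integral_iff nn_integral_eq_integral)
  then show ?thesis by (simp add: D_def J_def)
qed

end

lemma is_partition_mono:
  assumes "is_partition a b n p" "i \<le> j" "j \<le> n"
  shows "p i \<le> p j"
  using assms(2,3)
proof (induction j rule: dec_induct)
  case (step m)
  then have "p i \<le> p m" "p m < p (Suc m)"
    using assms(1) by (auto simp: is_partition_def)
  then show ?case by simp
qed simp

lemma is_partition_bounds:
  assumes "is_partition a b n p" "i \<le> n"
  shows "a \<le> p i" and "p i \<le> b"
  using is_partition_mono[OF assms(1), of 0 i] is_partition_mono[OF assms(1), of i n] assms
  by (auto simp: is_partition_def)

lemma step_fun_measurable [measurable]: "step_fun n p c \<in> borel_measurable borel"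
  unfolding step_fun_def[abs_def] by measurable

lemma step_fun_eq_0:
  assumes "is_partition a b n p" "s \<notin> {a..b}"
  shows "step_fun n p c s = 0"
  unfolding step_fun_def
proof (rule sum.neutral, safe)
  fix i assume "i < n"
  then have "a \<le> p i" "p (Suc i) \<le> b"
    using is_partition_bounds[OF assms(1), of i] is_partition_bounds[OF assms(1), of "Suc i"] by auto
  then show "c i * indicator {p i<..p (Suc i)} s = 0"
    using assms(2) by (auto simp: indicator_def)
qed

context standard_brownian_motion
begin

lemma step_integral_measurable:
  assumes "is_partition a b n p" "{a..b} \<subseteq> I"
  shows "step_integral B n p c \<in> borel_measurable M"
proof -
  have "B (p i) \<in> borel_measurable M" if "i \<le> n" for i
    using is_partition_bounds[OF assms(1) that] assms(2) by (intro random_variable) auto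
  then show ?thesis
    unfolding step_integral_def[abs_def]
    by (intro borel_measurable_sum borel_measurable_times borel_measurable_diff borel_measurable_const) auto
qed

lemma step_integral_isometry:
  assumes p: "is_partition a b n p" and "{a..b} \<subseteq> I"
  shows "(\<integral>\<^sup>+s. ennreal ((step_fun n p c s)\<^sup>2) \<partial>lborel) =
    (\<integral>\<^sup>+\<omega>. ennreal ((step_integral B n p c \<omega>)\<^sup>2) \<partial>M)"
proof -
  have "p i \<in> I" if "i \<le> n" for i
    using is_partition_bounds[OF p that] assms(2) by auto
  then show ?thesis
    unfolding step_fun_def step_integral_def using p
    by (intro isometry_of_increment_combinations) (auto simp: is_partition_def less_imp_le)
qed

text \<open>The intervals of both partitions form one family, indexed by the disjoint union of the two
  index sets; the coefficients of the second one enter with a minus sign.\<close>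

lemma step_integral_diff_isometry:
  assumes p: "is_partition a b n p" and q: "is_partition a b m q" and "{a..b} \<subseteq> I"
  shows "(\<integral>\<^sup>+s. ennreal ((step_fun n p c s - step_fun m q d s)\<^sup>2) \<partial>lborel) =
    (\<integral>\<^sup>+\<omega>. ennreal ((step_integral B n p c \<omega> - step_integral B m q d \<omega>)\<^sup>2) \<partial>M)"
proof -
  define A :: "(nat + nat) set" where "A = {..<n} <+> {..<m}"
  define l where "l = case_sum p q"
  define r where "r = case_sum (\<lambda>i. p (Suc i)) (\<lambda>i. q (Suc i))"
  define e where "e = case_sum c (\<lambda>i. - d i)"
  have pI: "p i \<in> I" if "i \<le> n" for i
    using is_partition_bounds[OF p that] assms(3) by auto
  have qI: "q i \<in> I" if "i \<le> m" for i
    using is_partition_bounds[OF q that] assms(3) by auto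
  have "(\<integral>\<^sup>+s. ennreal ((\<Sum>i\<in>A. e i * indicator {l i<..r i} s)\<^sup>2) \<partial>lborel) =
      (\<integral>\<^sup>+\<omega>. ennreal ((\<Sum>i\<in>A. e i * (B (r i) \<omega> - B (l i) \<omega>))\<^sup>2) \<partial>M)"
  proof (rule isometry_of_increment_combinations)
    show "l i \<in> I" "r i \<in> I" if "i \<in> A" for i
      using that pI qI by (auto simp: A_def l_def r_def)
    show "l i \<le> r i" if "i \<in> A" for i
      using that p q by (auto simp: A_def l_def r_def is_partition_def less_imp_le)
  qed (simp add: A_def)
  moreover have "(\<Sum>i\<in>A. e i * indicator {l i<..r i} s) = step_fun n p c s - step_fun m q d s" for s
    unfolding A_def step_fun_def by (subst sum.Plus) (simp_all add: e_def l_def r_def sum_negf)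
  moreover have "(\<Sum>i\<in>A. e i * (B (r i) \<omega> - B (l i) \<omega>)) =
      step_integral B n p c \<omega> - step_integral B m q d \<omega>" for \<omega>
    by (simp add: A_def e_def l_def r_def sum.Plus step_integral_def sum_negf)
  ultimately show ?thesis by simp
qed

end

section \<open>Approximation by step functions\<close>

lemma step_fun_eqI:
  assumes "is_partition a b n p" "j < n" "p j < s" "s \<le> p (Suc j)"
  shows "step_fun n p c s = c j"
proof -
  note mono = is_partition_mono[OF assms(1)]
  have "c i * indicator {p i<..p (Suc i)} s = (if i = j then c j else 0)" if "i < n" for i
  proof (cases i j rule: linorder_cases)
    case less
    then show ?thesis using mono[of "Suc i" j] assms by auto
  next
    case greater
    then show ?thesis using mono[of "Suc j" i] assms that by auto
  qed (use assms in auto)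
  then show ?thesis
    using \<open>j < n\<close> by (simp add: step_fun_def)
qed

definition uniform_grid :: "real \<Rightarrow> real \<Rightarrow> nat \<Rightarrow> nat \<Rightarrow> real" where
  "uniform_grid a b n i = a + real i * ((b - a) / real n)"

lemma is_partition_uniform_grid:
  assumes "a < b" "0 < n"
  shows "is_partition a b n (uniform_grid a b n)"
  using assms by (auto simp: is_partition_def uniform_grid_def field_simps)

lemma step_fun_uniform_grid_sample:
  assumes "a < b" "0 < n" "a < s" "s \<le> b"
  obtains q where "a \<le> q" "q < s" "s - q \<le> (b - a) / real n"
    "step_fun n (uniform_grid a b n) (\<lambda>i. f (uniform_grid a b n i)) s = f q"
proof -
  define x where "x = (s - a) * real n / (b - a)"
  \<comment> \<open>In units of the mesh, \<open>s\<close> lies at distance \<open>x\<close> from \<open>a\<close>. The cells are open on the left, so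
    the one that contains \<open>s\<close> is found by rounding \<open>x\<close> up.\<close>
  define j where "j = nat (\<lceil>x\<rceil> - 1)"
  have s: "s = a + x * ((b - a) / real n)"
    using assms by (simp add: x_def)
  have x: "0 < x" "x \<le> real n"
    using assms by (auto simp: x_def divide_le_eq)
  have "real j = real_of_int (\<lceil>x\<rceil> - 1)"
    using x by (simp add: j_def)
  then have jx: "real j < x" "x \<le> real j + 1"
    by linarith+
  then have "j < n" using x by linarith
  have h: "0 < (b - a) / real n" using assms by simp
  have 1: "uniform_grid a b n j < s"
    unfolding uniform_grid_def s using jx h by (intro add_strict_left_mono mult_strict_right_mono)
  have 2: "s \<le> uniform_grid a b n (Suc j)"
    unfolding uniform_grid_def s using jx h by (intro add_left_mono mult_right_mono) auto
  have "uniform_grid a b n (Suc j) = uniform_grid a b n j + (b - a) / real n"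
    by (simp add: uniform_grid_def distrib_right add_divide_distrib)
  with 2 have 3: "s - uniform_grid a b n j \<le> (b - a) / real n" by simp
  have 4: "a \<le> uniform_grid a b n j" using \<open>a < b\<close> by (simp add: uniform_grid_def)
  show ?thesis
    by (rule that[OF 4 1 3 step_fun_eqI[OF is_partition_uniform_grid[OF assms(1,2)] \<open>j < n\<close> 1 2]])
qed

text \<open>The step functions sample \<open>f\<close> at the left ends of the cells of a uniform grid, hence converge
  pointwise wherever \<open>f\<close> is continuous. The bound \<open>g\<close> at \<open>s\<close> controls \<open>f\<close> on all of \<open>[a, s]\<close>, so
  it controls the sample used at \<open>s\<close> as well as \<open>f s\<close> itself, and dominated convergence applies.
  In this form the lemma allows a square integrable singularity of \<open>f\<close> at \<open>b\<close>.\<close>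

lemma step_fun_L2_approximation:
  fixes f g :: "real \<Rightarrow> real"
  assumes "a < b"
    and f: "set_borel_measurable lborel {a..b} f" and g: "set_borel_measurable lborel {a..b} g"
    and cont: "continuous_on {a<..<b} f"
    and dom: "\<And>r s. a \<le> r \<Longrightarrow> r \<le> s \<Longrightarrow> s < b \<Longrightarrow> \<bar>f r\<bar> \<le> g s"
    and fin: "(\<integral>\<^sup>+s\<in>{a..b}. ennreal ((g s)\<^sup>2) \<partial>lborel) < \<infinity>"
  shows "(\<lambda>k. \<integral>\<^sup>+s\<in>{a..b}. ennreal ((f s - step_fun (Suc k) (uniform_grid a b (Suc k))
      (\<lambda>i. f (uniform_grid a b (Suc k) i)) s)\<^sup>2) \<partial>lborel) \<longlonglongrightarrow> 0"
proof -
  define \<sigma> where "\<sigma> k = step_fun (Suc k) (uniform_grid a b (Suc k))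
      (\<lambda>i. f (uniform_grid a b (Suc k) i))" for k
  define F where "F s = indicator {a..b} s * f s" for s
  define G where "G s = indicator {a..b} s * g s" for s
  have [measurable]: "F \<in> borel_measurable borel" "G \<in> borel_measurable borel"
    using f g by (simp_all add: F_def[abs_def] G_def[abs_def] set_borel_measurable_def)
  have [measurable]: "\<sigma> k \<in> borel_measurable borel" for k
    unfolding \<sigma>_def by measurable
  have sample: "\<exists>q. a \<le> q \<and> q < s \<and> s - q \<le> (b - a) / real (Suc k) \<and> \<sigma> k s = f q"
    if "a < s" "s < b" for s k
    unfolding \<sigma>_def
    by (rule step_fun_uniform_grid_sample[OF \<open>a < b\<close> zero_less_Suc[of k] \<open>a < s\<close> less_imp_le[OF \<open>s < b\<close>], where f = f])
       blast
  have G: "(\<integral>\<^sup>+s. ennreal ((G s)\<^sup>2) \<partial>lborel) < \<infinity>"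
  proof -
    have "(\<integral>\<^sup>+s. ennreal ((G s)\<^sup>2) \<partial>lborel) = (\<integral>\<^sup>+s\<in>{a..b}. ennreal ((g s)\<^sup>2) \<partial>lborel)"
      by (rule nn_integral_cong) (auto simp: G_def indicator_def)
    then show ?thesis using fin by simp
  qed
  have ae: "AE s in lborel. s \<noteq> a \<and> s \<noteq> b"
    using AE_lborel_singleton[of a] AE_lborel_singleton[of b] by auto
  have "(\<lambda>k. \<integral>\<^sup>+s. ennreal ((F s - indicator {a..b} s * \<sigma> k s)\<^sup>2) \<partial>lborel) \<longlonglongrightarrow> (\<integral>\<^sup>+s. 0 \<partial>(lborel::real measure))"
  proof (rule nn_integral_dominated_convergence)
    show "(\<integral>\<^sup>+s. 4 * ennreal ((G s)\<^sup>2) \<partial>lborel) < \<infinity>"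
      using G by (simp add: nn_integral_cmult ennreal_mult_less_top)
    show "AE s in lborel. ennreal ((F s - indicator {a..b} s * \<sigma> k s)\<^sup>2) \<le> 4 * ennreal ((G s)\<^sup>2)" for k
      using ae
    proof eventually_elim
      case (elim s)
      show ?case
      proof (cases "a < s \<and> s < b")
        case True
        then obtain q where q: "a \<le> q" "q < s" "\<sigma> k s = f q"
          using sample[of s k] by blast
        have "\<bar>f s\<bar> \<le> g s" "\<bar>f q\<bar> \<le> g s"
          using dom[of s s] dom[of q s] True q by auto
        then have "\<bar>f s - f q\<bar> \<le> \<bar>2 * g s\<bar>" by linarith
        then have "(f s - f q)\<^sup>2 \<le> (2 * g s)\<^sup>2"
          by (simp only: abs_le_square_iff)
        then have "(f s - f q)\<^sup>2 \<le> 4 * (g s)\<^sup>2"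
          by (simp add: power_mult_distrib)
        then have "ennreal ((f s - f q)\<^sup>2) \<le> ennreal (4 * (g s)\<^sup>2)" by (rule ennreal_leI)
        then show ?thesis
          using True q by (simp add: F_def G_def ennreal_mult)
      next
        case False
        then show ?thesis using elim by (auto simp: F_def indicator_def)
      qed
    qed
    show "AE s in lborel. (\<lambda>k. ennreal ((F s - indicator {a..b} s * \<sigma> k s)\<^sup>2)) \<longlonglongrightarrow> 0"
      using ae
    proof eventually_elim
      case (elim s)
      show ?case
      proof (cases "a < s \<and> s < b")
        case True
        then have "\<forall>k. \<exists>q. a \<le> q \<and> q < s \<and> s - q \<le> (b - a) / real (Suc k) \<and> \<sigma> k s = f q"
          using sample by blast
        then obtain q where q: "\<And>k. a \<le> q k" "\<And>k. q k < s"
            "\<And>k. s - q k \<le> (b - a) / real (Suc k)" "\<And>k. \<sigma> k s = f (q k)"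
          by metis
        have "(\<lambda>k. (b - a) / real (Suc k)) \<longlonglongrightarrow> 0"
          by (rule LIMSEQ_Suc) (rule lim_const_over_n)
        then have "(\<lambda>k. s - q k) \<longlonglongrightarrow> 0"
          by (rule tendsto_sandwich[OF _ _ tendsto_const, rotated 2])
             (use q in \<open>auto simp: less_imp_le simp del: of_nat_Suc\<close>)
        then have qs: "q \<longlonglongrightarrow> s"
          using tendsto_diff[OF tendsto_const[of s], of "\<lambda>k. s - q k" 0 sequentially] by simp
        have "isCont f s"
          using cont True by (simp add: continuous_on_eq_continuous_at)
        then have "(\<lambda>k. f (q k)) \<longlonglongrightarrow> f s"
          using qs by (rule isCont_tendsto_compose)
        then have "(\<lambda>k. (f s - f (q k))\<^sup>2) \<longlonglongrightarrow> (f s - f s)\<^sup>2"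
          by (intro tendsto_intros)
        then have "(\<lambda>k. ennreal ((f s - f (q k))\<^sup>2)) \<longlonglongrightarrow> ennreal ((f s - f s)\<^sup>2)"
          by (rule tendsto_ennrealI)
        then show ?thesis
          using True q(4) by (simp add: F_def)
      next
        case False
        then show ?thesis using elim by (auto simp: F_def indicator_def)
      qed
    qed
  qed auto
  moreover have "(F s - indicator {a..b} s * \<sigma> k s)\<^sup>2 = (f s - \<sigma> k s)\<^sup>2 * indicator {a..b} s" for k s
    by (auto simp: F_def indicator_def)
  ultimately show ?thesis
    by (simp add: \<sigma>_def ennreal_mult ennreal_indicator)
qed

section \<open>The Ito integral of a deterministic function\<close>

lemma set_nn_integral_step_error:
  assumes "is_partition a b n p"
  shows "(\<integral>\<^sup>+s\<in>{a..b}. ennreal ((f s - step_fun n p c s)\<^sup>2) \<partial>lborel) =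
    (\<integral>\<^sup>+s. ennreal ((indicator {a..b} s *\<^sub>R f s - step_fun n p c s)\<^sup>2) \<partial>lborel)"
  by (rule nn_integral_cong) (auto simp: indicator_def step_fun_eq_0[OF assms])

context standard_brownian_motion
begin

text \<open>This holds for every version of the integral, and therefore for the one that
  \<^const>\<open>ito_integral\<close> selects.\<close>

lemma ito_isometry:
  assumes X: "has_ito_integral M B a b f X" and "{a..b} \<subseteq> I"
  shows "(\<integral>\<^sup>+\<omega>. ennreal ((X \<omega>)\<^sup>2) \<partial>M) = (\<integral>\<^sup>+s\<in>{a..b}. ennreal ((f s)\<^sup>2) \<partial>lborel)"
proof -
  define F where "F s = indicator {a..b} s *\<^sub>R f s" for s
  obtain N P c where P: "\<And>k. is_partition a b (N k) (P k)"
    and f: "(\<lambda>k. \<integral>\<^sup>+s\<in>{a..b}. ennreal ((f s - step_fun (N k) (P k) (c k) s)\<^sup>2) \<partial>lborel) \<longlonglongrightarrow> 0"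
    and XS: "(\<lambda>k. \<integral>\<^sup>+\<omega>. ennreal ((X \<omega> - step_integral B (N k) (P k) (c k) \<omega>)\<^sup>2) \<partial>M) \<longlonglongrightarrow> 0"
    using X unfolding has_ito_integral_def by blast
  have XM: "X \<in> borel_measurable M" and FM: "F \<in> borel_measurable lborel"
    using X by (simp_all add: has_ito_integral_def set_borel_measurable_def F_def[abs_def])
  have Ff: "(\<lambda>k. \<integral>\<^sup>+s. ennreal ((F s - step_fun (N k) (P k) (c k) s)\<^sup>2) \<partial>lborel) \<longlonglongrightarrow> 0"
    using f by (simp add: set_nn_integral_step_error[OF P] F_def)
  have stepM: "step_fun (N k) (P k) (c k) \<in> borel_measurable lborel" for k
    by simp
  have SM: "step_integral B (N k) (P k) (c k) \<in> borel_measurable M" for k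
    by (rule step_integral_measurable[OF P \<open>{a..b} \<subseteq> I\<close>])
  note iso = step_integral_isometry[OF P \<open>{a..b} \<subseteq> I\<close>]
  have "(\<integral>\<^sup>+s. ennreal ((F s)\<^sup>2) \<partial>lborel) = (\<integral>\<^sup>+\<omega>. ennreal ((X \<omega>)\<^sup>2) \<partial>M)"
    by (rule antisym;
        rule nn_integral_square_le_of_isometric_approx[OF FM stepM XM SM iso Ff XS]
          nn_integral_square_le_of_isometric_approx[OF XM SM FM stepM iso[symmetric] XS Ff])
  moreover have "(\<integral>\<^sup>+s. ennreal ((F s)\<^sup>2) \<partial>lborel) = (\<integral>\<^sup>+s\<in>{a..b}. ennreal ((f s)\<^sup>2) \<partial>lborel)"
    by (rule nn_integral_cong) (auto simp: F_def indicator_def)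
  ultimately show ?thesis by simp
qed

text \<open>Along a subsequence the step functions converge geometrically in \<open>L\<^sup>2\<close>. The isometry carries this
  over to their integrals, which therefore have a limit.\<close>

lemma has_ito_integral_exists:
  assumes f: "set_borel_measurable lborel {a..b} f" and "{a..b} \<subseteq> I"
    and P: "\<And>k. is_partition a b (N k) (P k)"
    and approx: "(\<lambda>k. \<integral>\<^sup>+s\<in>{a..b}. ennreal ((f s - step_fun (N k) (P k) (c k) s)\<^sup>2) \<partial>lborel) \<longlonglongrightarrow> 0"
  shows "\<exists>X. has_ito_integral M B a b f X"
proof -
  define F where "F s = indicator {a..b} s *\<^sub>R f s" for s
  have [measurable]: "F \<in> borel_measurable borel"
    using f by (simp add: set_borel_measurable_def F_def[abs_def])
  define e where "e k = (\<integral>\<^sup>+s. ennreal ((F s - step_fun (N k) (P k) (c k) s)\<^sup>2) \<partial>lborel)" for k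
  have e: "e \<longlonglongrightarrow> 0"
    using approx by (simp add: set_nn_integral_step_error[OF P] F_def e_def[abs_def])
  have "\<exists>i. e i < ennreal ((1/4)^k)" for k :: nat
    using eventually_happens'[OF sequentially_bot order_tendstoD(2)[OF e, of "ennreal ((1/4)^k)"]]
    by auto
  then obtain \<phi> where \<phi>: "\<And>k. e (\<phi> k) < ennreal ((1/4)^k)" by metis
  define \<sigma> where "\<sigma> k = step_fun (N (\<phi> k)) (P (\<phi> k)) (c (\<phi> k))" for k
  define S where "S k = step_integral B (N (\<phi> k)) (P (\<phi> k)) (c (\<phi> k))" for k
  have [measurable]: "\<sigma> k \<in> borel_measurable borel" for k
    unfolding \<sigma>_def by measurable
  have F\<sigma>: "(\<integral>\<^sup>+s. ennreal ((F s - \<sigma> k s)\<^sup>2) \<partial>lborel) \<le> ennreal ((1/4)^k)" for k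
    using \<phi>[of k] by (simp add: e_def \<sigma>_def)
  have cauchy: "(\<integral>\<^sup>+\<omega>. ennreal ((S j \<omega> - S k \<omega>)\<^sup>2) \<partial>M) \<le> ennreal (4 * (1/4) ^ k)" if "k \<le> j" for j k
  proof -
    have "(\<integral>\<^sup>+\<omega>. ennreal ((S j \<omega> - S k \<omega>)\<^sup>2) \<partial>M) = (\<integral>\<^sup>+s. ennreal ((\<sigma> j s - \<sigma> k s)\<^sup>2) \<partial>lborel)"
      unfolding S_def \<sigma>_def by (rule step_integral_diff_isometry[OF P P \<open>{a..b} \<subseteq> I\<close>, symmetric])
    also have "\<dots> \<le> ennreal (1 + 1) * (\<integral>\<^sup>+s. ennreal ((\<sigma> j s - F s)\<^sup>2) \<partial>lborel) +
        ennreal (1 + 1 / 1) * (\<integral>\<^sup>+s. ennreal ((\<sigma> j s - \<sigma> k s - (\<sigma> j s - F s))\<^sup>2) \<partial>lborel)"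
      by (rule nn_integral_square_le_weighted) auto
    also have "\<dots> = 2 * (\<integral>\<^sup>+s. ennreal ((F s - \<sigma> j s)\<^sup>2) \<partial>lborel) + 2 * (\<integral>\<^sup>+s. ennreal ((F s - \<sigma> k s)\<^sup>2) \<partial>lborel)"
      by (simp add: power2_commute[of "\<sigma> j _"])
    also have "\<dots> \<le> 2 * ennreal ((1/4)^j) + 2 * ennreal ((1/4)^k)"
      by (intro add_mono mult_left_mono F\<sigma>) auto
    also have "\<dots> \<le> 2 * ennreal ((1/4)^k) + 2 * ennreal ((1/4)^k)"
      using that by (intro add_mono mult_left_mono ennreal_leI power_decreasing) auto
    also have "\<dots> = ennreal (4 * (1/4)^k)"
      by (simp add: ennreal_mult distrib_right[symmetric])
    finally show ?thesis .
  qed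
  have SM: "S k \<in> borel_measurable M" for k
    unfolding S_def by (rule step_integral_measurable[OF P \<open>{a..b} \<subseteq> I\<close>])
  obtain X where X: "X \<in> borel_measurable M"
    and XS: "(\<lambda>k. \<integral>\<^sup>+\<omega>. ennreal ((X \<omega> - S k \<omega>)\<^sup>2) \<partial>M) \<longlonglongrightarrow> 0"
    by (rule L2_limit_exists[OF SM cauchy]) auto
  have "(\<lambda>k. ennreal ((1/4)^k)) \<longlonglongrightarrow> ennreal 0"
    by (intro tendsto_ennrealI LIMSEQ_realpow_zero) auto
  then have "(\<lambda>k. \<integral>\<^sup>+s. ennreal ((F s - \<sigma> k s)\<^sup>2) \<partial>lborel) \<longlonglongrightarrow> 0"
    unfolding ennreal_0
    by (rule tendsto_sandwich[OF _ _ tendsto_const, rotated 2]) (auto simp: F\<sigma>)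
  then have "(\<lambda>k. \<integral>\<^sup>+s\<in>{a..b}. ennreal ((f s - \<sigma> k s)\<^sup>2) \<partial>lborel) \<longlonglongrightarrow> 0"
    by (simp add: \<sigma>_def set_nn_integral_step_error[OF P] F_def)
  then have "has_ito_integral M B a b f X"
    unfolding has_ito_integral_def \<sigma>_def
    by (intro conjI exI[of _ "\<lambda>k. N (\<phi> k)"] exI[of _ "\<lambda>k. P (\<phi> k)"] exI[of _ "\<lambda>k. c (\<phi> k)"] allI
        X f P XS[unfolded S_def])
  then show ?thesis by (rule exI[of _ X])
qed

end

section \<open>The power kernel\<close>

text \<open>For \<open>h < 1/2\<close> the integrand is unbounded at \<open>b\<close>, but its antiderivative is continuous up to
  \<open>b\<close>, so the fundamental theorem of calculus with derivatives in the interior applies.\<close>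

lemma nn_integral_powr_endpoint:
  fixes a b h :: real
  assumes "a \<le> b" "0 < h"
  shows "(\<integral>\<^sup>+s\<in>{a..b}. ennreal (((b - s) powr (h - 1/2))\<^sup>2) \<partial>lborel) = ennreal ((b - a) powr (2 * h) / (2 * h))"
proof -
  have eq: "((b - s) powr (h - 1/2))\<^sup>2 = (b - s) powr (2 * h - 1)" for s
    by (simp add: power2_eq_square powr_add[symmetric] algebra_simps)
  have "((\<lambda>s. (b - s) powr (2 * h - 1)) has_integral
      - ((b - b) powr (2 * h) / (2 * h)) - - ((b - a) powr (2 * h) / (2 * h))) {a..b}"
  proof (rule fundamental_theorem_of_calculus_interior[OF \<open>a \<le> b\<close>])
    show "continuous_on {a..b} (\<lambda>s. - ((b - s) powr (2 * h) / (2 * h)))"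
      using \<open>0 < h\<close> by (intro continuous_intros continuous_on_powr') auto
    show "((\<lambda>s. - ((b - s) powr (2 * h) / (2 * h))) has_vector_derivative (b - s) powr (2 * h - 1)) (at s)"
      if "s \<in> {a<..<b}" for s
      unfolding has_real_derivative_iff_has_vector_derivative[symmetric]
      using that \<open>0 < h\<close> by (auto intro!: derivative_eq_intros simp: field_simps)
  qed
  then have "((\<lambda>s. indicator {a..b} s * (b - s) powr (2 * h - 1)) has_integral
      (b - a) powr (2 * h) / (2 * h)) UNIV"
    by (subst (asm) has_integral_restrict_UNIV[symmetric])
       (simp add: indicator_def of_bool_def if_distrib[of "\<lambda>x. x * _"] cong: if_cong)
  then have "(\<integral>\<^sup>+s. ennreal (indicator {a..b} s * (b - s) powr (2 * h - 1)) \<partial>lborel) =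
      ennreal ((b - a) powr (2 * h) / (2 * h))"
    by (intro nn_integral_has_integral_lborel) auto
  then show ?thesis
    unfolding eq by (simp add: ennreal_mult ennreal_indicator mult.commute)
qed

text \<open>The kernel increases for \<open>h \<le> 1/2\<close> and decreases for \<open>h \<ge> 1/2\<close>, so its values to the left of
  \<open>s\<close> are bounded by its value at \<open>s\<close> or by its value at \<open>a\<close>; the sum of the two serves
  both cases.\<close>

lemma (in standard_brownian_motion) has_ito_integral_powr:
  assumes "a < b" "{a..b} \<subseteq> I" "0 < h"
  shows "\<exists>X. has_ito_integral M B a b (\<lambda>s. (b - s) powr (h - 1/2)) X"
proof -
  define f where "f s = (b - s) powr (h - 1/2)" for s
  define g where "g s = (b - a) powr (h - 1/2) + f s" for s
  have fM: "f \<in> borel_measurable borel" unfolding f_def[abs_def] by measurable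
  then have gM: "g \<in> borel_measurable borel" unfolding g_def[abs_def] by measurable
  have approx: "(\<lambda>k. \<integral>\<^sup>+s\<in>{a..b}. ennreal ((f s - step_fun (Suc k) (uniform_grid a b (Suc k))
      (\<lambda>i. f (uniform_grid a b (Suc k) i)) s)\<^sup>2) \<partial>lborel) \<longlonglongrightarrow> 0"
  proof (rule step_fun_L2_approximation[OF \<open>a < b\<close>, where g = g])
    show "continuous_on {a<..<b} f"
      unfolding f_def by (intro continuous_intros) auto
    show "\<bar>f r\<bar> \<le> g s" if "a \<le> r" "r \<le> s" "s < b" for r s
    proof (cases "h \<le> 1/2")
      case True
      then have "f r \<le> f s"
        unfolding f_def using that by (intro powr_mono2') auto
      then show ?thesis by (simp add: g_def f_def add_increasing)
    next
      case False
      then have "f r \<le> (b - a) powr (h - 1/2)"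
        unfolding f_def using that by (intro powr_mono2) auto
      then show ?thesis by (simp add: g_def f_def add_increasing2)
    qed
    have "(\<integral>\<^sup>+s\<in>{a..b}. ennreal ((g s)\<^sup>2) \<partial>lborel) \<le>
        (\<integral>\<^sup>+s\<in>{a..b}. ennreal (2 * ((b - a) powr (h - 1/2))\<^sup>2) + 2 * ennreal ((f s)\<^sup>2) \<partial>lborel)"
    proof (intro nn_integral_mono mult_right_mono)
      fix s
      have "(g s)\<^sup>2 \<le> 2 * ((b - a) powr (h - 1/2))\<^sup>2 + 2 * (f s)\<^sup>2"
        using square_le_weighted[of 1 "g s" "(b - a) powr (h - 1/2)"] by (simp add: g_def)
      then show "ennreal ((g s)\<^sup>2) \<le> ennreal (2 * ((b - a) powr (h - 1/2))\<^sup>2) + 2 * ennreal ((f s)\<^sup>2)"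
        by (rule order_trans[OF ennreal_leI]) (simp add: ennreal_mult)
    qed simp
    also have "\<dots> = ennreal (2 * ((b - a) powr (h - 1/2))\<^sup>2) * emeasure lborel {a..b} +
        2 * (\<integral>\<^sup>+s\<in>{a..b}. ennreal ((f s)\<^sup>2) \<partial>lborel)"
      using fM by (simp add: distrib_right nn_integral_add nn_integral_cmult mult.assoc)
    also have "\<dots> < \<infinity>"
      unfolding f_def nn_integral_powr_endpoint[OF less_imp_le[OF \<open>a < b\<close>] \<open>0 < h\<close>]
      using \<open>a < b\<close> by (simp add: ennreal_mult_less_top)
    finally show "(\<integral>\<^sup>+s\<in>{a..b}. ennreal ((g s)\<^sup>2) \<partial>lborel) < \<infinity>" .
  qed (use fM gM in \<open>simp_all add: set_borel_measurable_def\<close>)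
  have "set_borel_measurable lborel {a..b} f"
    using fM by (simp add: set_borel_measurable_def)
  then have "\<exists>X. has_ito_integral M B a b f X"
    by (rule has_ito_integral_exists[OF _ \<open>{a..b} \<subseteq> I\<close> is_partition_uniform_grid[OF \<open>a < b\<close> zero_less_Suc] approx])
  then show ?thesis by (simp add: f_def[abs_def])
qed

text \<open>The normalization \<open>sqrt (2 * H (t + \<epsilon>))\<close> cancels the constant from the integral of the squared
  kernel, so that a pure power of \<open>\<epsilon>\<close> remains.\<close>

lemma (in standard_brownian_motion) second_moment_I1_loc:
  assumes "0 < \<epsilon>" "{t..t + \<epsilon>} \<subseteq> I" "0 < H (t + \<epsilon>)"
  shows "expectation (\<lambda>\<omega>. (I1_loc M B H t \<epsilon> \<omega>)\<^sup>2) = \<epsilon> powr (2 * H (t + \<epsilon>))"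
proof -
  define h where "h = H (t + \<epsilon>)"
  define X where "X = ito_integral M B t (t + \<epsilon>) (\<lambda>s. (t + \<epsilon> - s) powr (h - 1/2))"
  have X: "has_ito_integral M B t (t + \<epsilon>) (\<lambda>s. (t + \<epsilon> - s) powr (h - 1/2)) X"
    unfolding X_def ito_integral_def
    by (rule someI_ex[OF has_ito_integral_powr]) (use assms in \<open>auto simp: h_def\<close>)
  have [measurable]: "X \<in> borel_measurable M"
    using X by (simp add: has_ito_integral_def)
  have "(\<integral>\<^sup>+\<omega>. ennreal ((X \<omega>)\<^sup>2) \<partial>M) = ennreal (\<epsilon> powr (2 * h) / (2 * h))"
    using ito_isometry[OF X assms(2)] nn_integral_powr_endpoint[of t "t + \<epsilon>" h] assms
    by (simp add: h_def)
  then have "expectation (\<lambda>\<omega>. (X \<omega>)\<^sup>2) = \<epsilon> powr (2 * h) / (2 * h)"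
    using assms by (simp add: integral_eq_nn_integral h_def)
  then show ?thesis
    using assms by (simp add: I1_loc_def X_def h_def power_mult_distrib)
qed

section \<open>Perturbation of the exponent\<close>

lemma abs_exp_minus_1_le:
  fixes x :: real
  assumes "\<bar>x\<bar> \<le> 1"
  shows "\<bar>exp x - 1\<bar> \<le> 2 * \<bar>x\<bar>"
proof (cases "0 \<le> x")
  case True
  then have "x\<^sup>2 \<le> x"
    using assms by (simp add: power2_eq_square mult_left_le)
  then show ?thesis
    using True assms exp_bound[of x] by simp
next
  case False
  then have "exp x \<le> 1" by simp
  then show ?thesis
    using False exp_ge_add_one_self[of x] by linarith
qed

text \<open>The left-hand side is \<open>exp y - 1\<close> for \<open>y = 2 * (H (t + \<epsilon>) - H t) * ln \<epsilon>\<close>, which is of order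
  \<open>\<epsilon> powr \<gamma> * \<bar>ln \<epsilon>\<bar>\<close>. The logarithm is absorbed by passing to an exponent below
  \<open>\<gamma>\<close>.\<close>

lemma holder_exponent_perturbation_bigo:
  fixes H :: "real \<Rightarrow> real"
  assumes H: "\<forall>\<^sub>F \<epsilon> in at_right 0. \<bar>H (t + \<epsilon>) - H t\<bar> \<le> C * \<epsilon> powr \<gamma>"
    and "0 < \<gamma>" "\<beta> < \<gamma>"
  shows "(\<lambda>\<epsilon>. \<epsilon> powr (2 * (H (t + \<epsilon>) - H t)) - 1) \<in> O[at_right 0](\<lambda>\<epsilon>. \<epsilon> powr \<beta>)"
proof (rule bigoI)
  have "((\<lambda>\<epsilon>::real. 2 * C * \<epsilon> powr \<gamma> * ln \<epsilon>) \<longlongrightarrow> 0) (at_right 0)"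
    using \<open>0 < \<gamma>\<close> by real_asymp
  then have small: "\<forall>\<^sub>F \<epsilon> in at_right 0. \<bar>2 * C * \<epsilon> powr \<gamma> * ln \<epsilon>\<bar> < 1"
    by (auto dest: tendstoD[where e = 1])
  have "((\<lambda>\<epsilon>::real. \<epsilon> powr (\<gamma> - \<beta>) * ln \<epsilon>) \<longlongrightarrow> 0) (at_right 0)"
    using \<open>\<beta> < \<gamma>\<close> by real_asymp
  then have log: "\<forall>\<^sub>F \<epsilon> in at_right 0. \<bar>\<epsilon> powr (\<gamma> - \<beta>) * ln \<epsilon>\<bar> < 1"
    by (auto dest: tendstoD[where e = 1])
  have "\<forall>\<^sub>F \<epsilon> in at_right 0. (0::real) < \<epsilon>"
    by (simp add: eventually_at_right_less)
  with H small log
  show "\<forall>\<^sub>F \<epsilon> in at_right 0. norm (\<epsilon> powr (2 * (H (t + \<epsilon>) - H t)) - 1) \<le> (4 * \<bar>C\<bar>) * norm (\<epsilon> powr \<beta>)"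
  proof eventually_elim
    case (elim \<epsilon>)
    define y where "y = 2 * (H (t + \<epsilon>) - H t) * ln \<epsilon>"
    have "\<bar>y\<bar> \<le> 2 * (C * \<epsilon> powr \<gamma>) * \<bar>ln \<epsilon>\<bar>"
      unfolding y_def abs_mult using elim(1) by (intro mult_right_mono) auto
    also have "\<dots> \<le> 2 * (\<bar>C\<bar> * \<epsilon> powr \<gamma>) * \<bar>ln \<epsilon>\<bar>"
      by (intro mult_right_mono mult_left_mono) auto
    finally have y: "\<bar>y\<bar> \<le> 2 * \<bar>C\<bar> * (\<epsilon> powr \<gamma> * \<bar>ln \<epsilon>\<bar>)"
      by (simp only: mult.assoc)
    have "\<bar>y\<bar> \<le> 1"
      using y elim(2) by (simp add: abs_mult mult.assoc)
    then have "\<bar>exp y - 1\<bar> \<le> 2 * \<bar>y\<bar>"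
      using abs_exp_minus_1_le[of y] by simp
    also have "\<dots> \<le> 4 * \<bar>C\<bar> * (\<epsilon> powr \<gamma> * \<bar>ln \<epsilon>\<bar>)"
      using y by linarith
    also have "\<epsilon> powr \<gamma> * \<bar>ln \<epsilon>\<bar> = \<epsilon> powr \<beta> * \<bar>\<epsilon> powr (\<gamma> - \<beta>) * ln \<epsilon>\<bar>"
      by (simp add: abs_mult mult.assoc[symmetric] powr_add[symmetric])
    also have "\<dots> \<le> \<epsilon> powr \<beta> * 1"
      using elim(3) by (intro mult_left_mono) auto
    finally have "\<bar>exp y - 1\<bar> \<le> 4 * \<bar>C\<bar> * \<epsilon> powr \<beta>" by (simp add: mult_left_mono)
    then show ?case
      using elim(4) by (simp add: powr_def y_def)
  qed
qed

theorem theorem3p3: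
  fixes T \<gamma> t :: real and H :: "real \<Rightarrow> real"
    and M :: "'a measure" and B :: "real \<Rightarrow> 'a \<Rightarrow> real"
  assumes "T > 0"
    and "\<And>s. s \<in> {0..T} \<Longrightarrow> 0 < H s \<and> H s < 1"
    and "Holder_continuous_on {0..T} \<gamma> H"
    and "\<gamma> > (SUP s\<in>{0..T}. H s)"
    and "standard_brownian_motion M {0..T} B"
    and "t \<in> {0..<T}"
  shows "\<exists>R. R \<in> O[at_right 0](\<lambda>\<epsilon>. \<epsilon> powr (min (\<gamma> - H t) ((\<gamma> + H t) / 2))) \<and>
           (\<forall>\<^sub>F \<epsilon> in at_right 0.
              (\<integral>\<omega>. (I1_loc M B H t \<epsilon> \<omega>)\<^sup>2 \<partial>M) = \<epsilon> powr (2 * H t) * (1 + R \<epsilon>))"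
proof -
  interpret standard_brownian_motion M "{0..T}" B by fact
  define R where "R \<epsilon> = \<epsilon> powr (2 * (H (t + \<epsilon>) - H t)) - 1" for \<epsilon>
  obtain C where "0 < \<gamma>" and C: "\<And>u v. u \<in> {0..T} \<Longrightarrow> v \<in> {0..T} \<Longrightarrow> \<bar>H v - H u\<bar> \<le> C * \<bar>v - u\<bar> powr \<gamma>"
    using assms(3) unfolding Holder_continuous_on_def by blast
  have Ht: "0 < H t" using assms(2)[of t] assms(6) by simp
  \<comment> \<open>The integral runs over \<open>[t, t + \<epsilon>]\<close>, which has to stay inside the time set \<open>[0, T]\<close>.\<close>
  have near: "\<forall>\<^sub>F \<epsilon> in at_right 0. 0 < \<epsilon> \<and> t + \<epsilon> \<in> {0..T}"
    using assms(6) by (intro eventually_at_rightI[of 0 "T - t"]) auto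
  have "R \<in> O[at_right 0](\<lambda>\<epsilon>. \<epsilon> powr (min (\<gamma> - H t) ((\<gamma> + H t) / 2)))"
    unfolding R_def
  proof (rule holder_exponent_perturbation_bigo)
    show "\<forall>\<^sub>F \<epsilon> in at_right 0. \<bar>H (t + \<epsilon>) - H t\<bar> \<le> C * \<epsilon> powr \<gamma>"
      using near
    proof eventually_elim
      case (elim \<epsilon>)
      then show ?case using C[of t "t + \<epsilon>"] assms(6) by simp
    qed
    \<comment> \<open>Positivity of \<open>H t\<close> puts the exponent strictly below \<open>\<gamma>\<close>, which makes room for the logarithm.\<close>
    show "min (\<gamma> - H t) ((\<gamma> + H t) / 2) < \<gamma>" using Ht by simp
  qed fact
  moreover have "\<forall>\<^sub>F \<epsilon> in at_right 0.
      (\<integral>\<omega>. (I1_loc M B H t \<epsilon> \<omega>)\<^sup>2 \<partial>M) = \<epsilon> powr (2 * H t) * (1 + R \<epsilon>)"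
    using near
  proof eventually_elim
    case (elim \<epsilon>)
    then have "(\<integral>\<omega>. (I1_loc M B H t \<epsilon> \<omega>)\<^sup>2 \<partial>M) = \<epsilon> powr (2 * H (t + \<epsilon>))"
      using assms(2)[of "t + \<epsilon>"] assms(6) by (intro second_moment_I1_loc) auto
    also have "\<dots> = \<epsilon> powr (2 * H t) * (1 + R \<epsilon>)"
      by (simp add: R_def powr_add[symmetric] algebra_simps)
    finally show ?case .
  qed
  ultimately show ?thesis by blast
qed

end
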